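(* Let $\mathcal{X}$ be a separable Banach space, let $\{m_n\}$ be an increasing sequence of positive integers, and let $(\{x_n\},\{h_{n,i}\}_{n\in\mathbb{N},\,1\le i\le m_n})$ be an approximative atomic decomposition for $\mathcal{X}$ with respect to a BK-space $\mathcal{X}_d$, with bounds $A$ and $B$. Let $K\in L(\mathcal{X})$, $K\neq 0$, have closed range. Then $(\{Kx_n\},\{h_{n,i}\}_{n\in\mathbb{N},\,1\le i\le m_n})$ is an approximative $K$-atomic decomposition for $\mathcal{X}$ with respect to $\mathcal{X}_d$ with bounds $\frac{A}{\|K\|}$ and $B$.
   Context: Scalars are $\mathbb{R}$ or $\mathbb{C}$. $L(\mathcal{X})$ is the space of bounded linear operators on $\mathcal{X}$, and $\mathcal{X}^*$ is the dual space. Given an increasing sequence $\{m_n\}_{n\in\mathbb{N}}$ of positive integers, a BK-space $\mathcal{X}_d$ here is a Banach space whose elements are scalar families $\{c_{n,i}\}_{n\in\mathbb{N},\,1\le i\le m_n}$ (with coordinatewise linear operations) and on which every coordinate functional is continuous. Definition. Let $K\in L(\mathcal{X})$, $\{x_n\}\subset\mathcal{X}$, and $\{h_{n,i}\}_{n\in\mathbb{N},\,1\le i\le m_n}\subset\mathcal{X}^*$. The pair $(\{x_n\},\{h_{n,i}\})$ is an approximative $K$-atomic decomposition for $\mathcal{X}$ with respect to $\mathcal{X}_d$ if: (a) $\{h_{n,i}(x)\}_{n\in\mathbb{N},1\le i\le m_n}\in\mathcal{X}_d$ for all $x\in\mathcal{X}$; (b) there exist constants $A$ and $B$ with $0<A\le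 B<\infty$ such that $A\|K(x)\|_{\mathcal{X}}\le \|\{h_{n,i}(x)\}\|_{\mathcal{X}_d}\le B\|x\|_{\mathcal{X}}$ for all $x\in\mathcal{X}$; (c) for all $x\in\mathcal{X}$ the limit $\lim_{n\to\infty}\sum_{i=1}^{m_n}h_{n,i}(x)x_i$ exists in $\mathcal{X}$ and equals $K(x)$. The constants $A$ and $B$ in (b) are called lower and upper bounds of the approximative $K$-atomic decomposition. An approximative atomic decomposition is an approximative $K$-atomic decomposition with $K=I_{\mathcal{X}}$, the identity operator.
   Formalization: "Bounds A/‖K‖ and B" means both are positive and satisfy the lower and upper inequality; A/‖K‖ ≤ B, which the definition asks of bounds, is not claimed for this pair (it fails for X = ℝ, A = B = 1, K = 0.1·I), only that some bounds in the right order exist. *)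

theory Defs
  imports "HOL-Analysis.Analysis"
begin

text \<open>
  The scalars form a type of class \<^class>\<open>real_normed_field\<close>: since the norm is multiplicative and
  extends the absolute value of the reals, the Gelfand--Mazur theorem leaves, up to isometric
  isomorphism, exactly the real and the complex numbers. The type class \<^class>\<open>banach\<close> only knows
  multiplication by reals, so multiplication by the scalars is a separate argument \<open>smul\<close> which
  extends it.
\<close>

locale banach_space_over = vector_space smul
  for smul :: "'k::real_normed_field \<Rightarrow> 'x::banach \<Rightarrow> 'x" +
  assumes norm_scale: "norm (smul a x) = norm a * norm x"
    and scale_of_real: "smul (of_real r) x = r *\<^sub>R x"

text \<open>
  For a scalar-linear operator, boundedness does not depend on whether the space is
  regarded as a space over the scalars or over the reals, and its norm is \<^const>\<open>onorm\<close>.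
\<close>

definition bounded_operator ::
    "('k::real_normed_field \<Rightarrow> 'x::banach \<Rightarrow> 'x) \<Rightarrow> ('x \<Rightarrow> 'x) \<Rightarrow> bool" where
  "bounded_operator smul T \<longleftrightarrow> bounded_linear T \<and> Vector_Spaces.linear smul smul T"

definition bounded_functional ::
    "('k::real_normed_field \<Rightarrow> 'x::banach \<Rightarrow> 'x) \<Rightarrow> ('x \<Rightarrow> 'k) \<Rightarrow> bool" where
  "bounded_functional smul f \<longleftrightarrow> bounded_linear f \<and> Vector_Spaces.linear smul (*) f"


text \<open>
  A family \<open>c n i\<close> with \<open>1 \<le> i \<le> m n\<close> is represented by a function that is zero outside this
  index set. Rows are numbered from \<open>0\<close>; the inner index starts at \<open>1\<close>.
\<close>

definition supported :: "(nat \<Rightarrow> nat) \<Rightarrow> (nat \<Rightarrow> nat \<Rightarrow> 'k::zero) \<Rightarrow> bool" where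
  "supported m c \<longleftrightarrow> (\<forall>n i. i \<notin> {1..m n} \<longrightarrow> c n i = 0)"

locale normed_family_space =
  fixes m :: "nat \<Rightarrow> nat"
    and S :: "(nat \<Rightarrow> nat \<Rightarrow> 'k::real_normed_field) set"
    and N :: "(nat \<Rightarrow> nat \<Rightarrow> 'k) \<Rightarrow> real"
  assumes supp: "c \<in> S \<Longrightarrow> supported m c"
    and zero_mem: "(\<lambda>n i. 0) \<in> S"
    and add_mem: "\<lbrakk>c \<in> S; e \<in> S\<rbrakk> \<Longrightarrow> (\<lambda>n i. c n i + e n i) \<in> S"
    and scale_mem: "c \<in> S \<Longrightarrow> (\<lambda>n i. a * c n i) \<in> S"
    and N_nonneg: "c \<in> S \<Longrightarrow> 0 \<le> N c"
    and N_eq_0_iff: "c \<in> S \<Longrightarrow> N c = 0 \<longleftrightarrow> c = (\<lambda>n i. 0)"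
    and N_scale: "c \<in> S \<Longrightarrow> N (\<lambda>n i. a * c n i) = norm a * N c"
    and N_triangle: "\<lbrakk>c \<in> S; e \<in> S\<rbrakk> \<Longrightarrow> N (\<lambda>n i. c n i + e n i) \<le> N c + N e"
begin

text \<open>The locale \<^locale>\<open>Metric_space\<close> demands nonnegativity and symmetry also off the carrier.\<close>

definition family_dist :: "(nat \<Rightarrow> nat \<Rightarrow> 'k) \<Rightarrow> (nat \<Rightarrow> nat \<Rightarrow> 'k) \<Rightarrow> real" where
  "family_dist c e = (if c \<in> S \<and> e \<in> S then N (\<lambda>n i. c n i - e n i) else 0)"

lemma diff_mem:
  assumes "c \<in> S" "e \<in> S"
  shows "(\<lambda>n i. c n i - e n i) \<in> S"
  using add_mem[OF assms(1) scale_mem[OF assms(2), of "-1"]] by simp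

sublocale Metric_space S family_dist
proof
  fix c e :: "nat \<Rightarrow> nat \<Rightarrow> 'k"
  show "0 \<le> family_dist c e"
    by (simp add: family_dist_def N_nonneg diff_mem)
  show "family_dist c e = family_dist e c"
    using N_scale[OF diff_mem, of c e "-1"] by (simp add: family_dist_def)
next
  fix c e :: "nat \<Rightarrow> nat \<Rightarrow> 'k"
  assume "c \<in> S" "e \<in> S"
  then show "family_dist c e = 0 \<longleftrightarrow> c = e"
    by (simp add: family_dist_def N_eq_0_iff diff_mem fun_eq_iff)
next
  fix c e f :: "nat \<Rightarrow> nat \<Rightarrow> 'k"
  assume "c \<in> S" "e \<in> S" "f \<in> S"
  then show "family_dist c f \<le> family_dist c e + family_dist e f"
    using N_triangle[OF diff_mem diff_mem, of c e e f] by (simp add: family_dist_def)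
qed

end

locale bk_space = normed_family_space +
  assumes complete: "mcomplete"
    and coordinate_continuous: "i \<in> {1..m n} \<Longrightarrow> continuous_map mtopology euclidean (\<lambda>c. c n i)"


definition analysis_family ::
    "(nat \<Rightarrow> nat) \<Rightarrow> (nat \<Rightarrow> nat \<Rightarrow> 'x \<Rightarrow> 'k::zero) \<Rightarrow> 'x \<Rightarrow> nat \<Rightarrow> nat \<Rightarrow> 'k" where
  "analysis_family m h x = (\<lambda>n i. if i \<in> {1..m n} then h n i x else 0)"

definition lower_bound ::
    "(nat \<Rightarrow> nat) \<Rightarrow> ((nat \<Rightarrow> nat \<Rightarrow> 'k::zero) \<Rightarrow> real) \<Rightarrow> ('x::real_normed_vector \<Rightarrow> 'x)
      \<Rightarrow> (nat \<Rightarrow> nat \<Rightarrow> 'x \<Rightarrow> 'k) \<Rightarrow> real \<Rightarrow> bool" where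
  "lower_bound m N K h A \<longleftrightarrow> 0 < A \<and> (\<forall>x. A * norm (K x) \<le> N (analysis_family m h x))"

definition upper_bound ::
    "(nat \<Rightarrow> nat) \<Rightarrow> ((nat \<Rightarrow> nat \<Rightarrow> 'k::zero) \<Rightarrow> real)
      \<Rightarrow> (nat \<Rightarrow> nat \<Rightarrow> 'x::real_normed_vector \<Rightarrow> 'k) \<Rightarrow> real \<Rightarrow> bool" where
  "upper_bound m N h B \<longleftrightarrow> 0 < B \<and> (\<forall>x. N (analysis_family m h x) \<le> B * norm x)"

text \<open>Only the \<open>x i\<close> with \<open>i \<ge> 1\<close> and the \<open>h n i\<close> with \<open>1 \<le> i \<le> m n\<close> matter.\<close>

definition approx_K_atomic_decomposition ::
    "('k::real_normed_field \<Rightarrow> 'x::banach \<Rightarrow> 'x) \<Rightarrow> (nat \<Rightarrow> nat)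
      \<Rightarrow> (nat \<Rightarrow> nat \<Rightarrow> 'k) set \<Rightarrow> ((nat \<Rightarrow> nat \<Rightarrow> 'k) \<Rightarrow> real)
      \<Rightarrow> ('x \<Rightarrow> 'x) \<Rightarrow> (nat \<Rightarrow> 'x) \<Rightarrow> (nat \<Rightarrow> nat \<Rightarrow> 'x \<Rightarrow> 'k) \<Rightarrow> bool" where
  "approx_K_atomic_decomposition smul m S N K x h \<longleftrightarrow>
     bounded_operator smul K \<and>
     (\<forall>n. \<forall>i\<in>{1..m n}. bounded_functional smul (h n i)) \<and>
     (\<forall>y. analysis_family m h y \<in> S) \<and>
     (\<exists>A B. A \<le> B \<and> lower_bound m N K h A \<and> upper_bound m N h B) \<and>
     (\<forall>y. (\<lambda>n. \<Sum>i=1..m n. smul (h n i y) (x i)) \<longlonglongrightarrow> K y)"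

text \<open>
  A decomposition has bounds \<open>A\<close> and \<open>B\<close> if these constants satisfy the two inequalities.
  The condition \<open>A \<le> B\<close> is only part of the existence statement above: any lower bound may be
  decreased to meet it. It is automatic for the identity operator on a nonzero space, but for
  general \<open>K\<close> two bounds may violate it (take \<open>K\<close> to be a small multiple of the identity).
\<close>

definition approx_K_atomic_decomposition_with_bounds ::
    "('k::real_normed_field \<Rightarrow> 'x::banach \<Rightarrow> 'x) \<Rightarrow> (nat \<Rightarrow> nat)
      \<Rightarrow> (nat \<Rightarrow> nat \<Rightarrow> 'k) set \<Rightarrow> ((nat \<Rightarrow> nat \<Rightarrow> 'k) \<Rightarrow> real)
      \<Rightarrow> ('x \<Rightarrow> 'x) \<Rightarrow> (nat \<Rightarrow> 'x) \<Rightarrow> (nat \<Rightarrow> nat \<Rightarrow> 'x \<Rightarrow> 'k) \<Rightarrow> real \<Rightarrow> real \<Rightarrow> bool" where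
  "approx_K_atomic_decomposition_with_bounds smul m S N K x h A B \<longleftrightarrow>
     approx_K_atomic_decomposition smul m S N K x h \<and>
     lower_bound m N K h A \<and> upper_bound m N h B"

abbreviation approx_atomic_decomposition_with_bounds ::
    "('k::real_normed_field \<Rightarrow> 'x::banach \<Rightarrow> 'x) \<Rightarrow> (nat \<Rightarrow> nat)
      \<Rightarrow> (nat \<Rightarrow> nat \<Rightarrow> 'k) set \<Rightarrow> ((nat \<Rightarrow> nat \<Rightarrow> 'k) \<Rightarrow> real)
      \<Rightarrow> (nat \<Rightarrow> 'x) \<Rightarrow> (nat \<Rightarrow> nat \<Rightarrow> 'x \<Rightarrow> 'k) \<Rightarrow> real \<Rightarrow> real \<Rightarrow> bool" where
  "approx_atomic_decomposition_with_bounds smul m S N x h A B \<equiv>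
     approx_K_atomic_decomposition_with_bounds smul m S N id x h A B"

end

theory Submission
  imports Defs
begin

text \<open>
  Applying \<open>K\<close> to the reconstruction \<open>y = lim (\<Sum>i=1..m n. smul (h n i y) (x i))\<close> gives the limit
  required for \<open>K y\<close>, because \<open>K\<close> is continuous and linear over the scalars. The coefficient
  families are unchanged, so membership in the sequence space and the upper bound carry over
  verbatim. The lower bound follows from \<open>\<parallel>K y\<parallel> \<le> \<parallel>K\<parallel> \<parallel>y\<parallel>\<close>: dividing by \<open>\<parallel>K\<parallel> > 0\<close> gives
  \<open>(A / \<parallel>K\<parallel>) \<parallel>K y\<parallel> \<le> A \<parallel>y\<parallel>\<close>, which is at most the norm of the coefficient family of \<open>y\<close>.

  The number \<open>A / \<parallel>K\<parallel>\<close> may exceed \<open>B\<close> when \<open>\<parallel>K\<parallel>\<close> is small. A decomposition must have some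
  pair of bounds in the right order; the pair \<open>min (A / \<parallel>K\<parallel>) B\<close> and \<open>B\<close> provides it
  (lemma \<open>ordered_bounds_exist\<close>).
\<close>

lemma lower_bound_comp_bounded_linear:
  fixes T :: "'x::real_normed_vector \<Rightarrow> 'x"
  assumes low: "lower_bound m N id h A" and T: "bounded_linear T" and nz: "T \<noteq> (\<lambda>y. 0)"
  shows "lower_bound m N T h (A / onorm T)"
proof -
  have pos: "0 < onorm T"
    using nz by (auto simp: onorm_pos_lt[OF T])
  have "A / onorm T * norm (T y) \<le> N (analysis_family m h y)" for y
  proof -
    have "A / onorm T * norm (T y) \<le> A / onorm T * (onorm T * norm y)"
      using low pos by (intro mult_left_mono onorm[OF T]) (simp add: lower_bound_def)
    also have "\<dots> = A * norm y"
      using pos by simp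
    also have "\<dots> \<le> N (analysis_family m h y)"
      using low by (simp add: lower_bound_def)
    finally show ?thesis .
  qed
  then show ?thesis
    using low pos by (simp add: lower_bound_def)
qed

text \<open>Lower bounds may be decreased, so any two bounds yield a pair in the right order.\<close>

lemma ordered_bounds_exist:
  assumes low: "lower_bound m N K h A" and up: "upper_bound m N h B"
  shows "\<exists>A B. A \<le> B \<and> lower_bound m N K h A \<and> upper_bound m N h B"
proof -
  have "min A B * norm (K y) \<le> N (analysis_family m h y)" for y
  proof -
    have "min A B * norm (K y) \<le> A * norm (K y)"
      by (intro mult_right_mono) auto
    then show ?thesis
      using low unfolding lower_bound_def by (meson order_trans)
  qed
  then have "lower_bound m N K h (min A B)"
    using low up by (simp add: lower_bound_def upper_bound_def)
  then show ?thesis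
    using up min.cobounded2 by blast
qed

lemma bounded_operator_tendsto_sum:
  assumes T: "bounded_operator smul T"
    and lim: "(\<lambda>n. \<Sum>i\<in>I n. smul (c n i) (x i)) \<longlonglongrightarrow> y"
  shows "(\<lambda>n. \<Sum>i\<in>I n. smul (c n i) (T (x i))) \<longlonglongrightarrow> T y"
proof -
  have bl: "bounded_linear T" and lin: "Vector_Spaces.linear smul smul T"
    using T by (auto simp: bounded_operator_def)
  have "T (\<Sum>i\<in>I n. smul (c n i) (x i)) = (\<Sum>i\<in>I n. smul (c n i) (T (x i)))" for n
    by (simp add: linear_sum[OF bounded_linear.linear[OF bl]]
        module_hom.scale[OF lin[folded module_hom_iff_linear]])
  with bounded_linear.tendsto[OF bl lim] show ?thesis
    by simp
qed

theorem theorem2p6: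
  fixes smul :: "'k::real_normed_field \<Rightarrow> 'x::banach \<Rightarrow> 'x"
    and m :: "nat \<Rightarrow> nat"
    and S :: "(nat \<Rightarrow> nat \<Rightarrow> 'k) set"
    and N :: "(nat \<Rightarrow> nat \<Rightarrow> 'k) \<Rightarrow> real"
    and x :: "nat \<Rightarrow> 'x"
    and h :: "nat \<Rightarrow> nat \<Rightarrow> 'x \<Rightarrow> 'k"
    and K :: "'x \<Rightarrow> 'x"
    and A B :: real
  assumes "banach_space_over smul"
    and "separable_space (euclidean :: 'x topology)"
    and "mono m" and "\<forall>n. 0 < m n"
    and "bk_space m S N"
    and "approx_atomic_decomposition_with_bounds smul m S N x h A B"
    and "bounded_operator smul K"
    and "K \<noteq> (\<lambda>y. 0)"
    and "closed (range K)"
  shows "approx_K_atomic_decomposition_with_bounds smul m S N K (\<lambda>n. K (x n)) h (A / onorm K) B"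
proof -
  have decomp: "approx_K_atomic_decomposition smul m S N id x h"
    and low: "lower_bound m N id h A" and up: "upper_bound m N h B"
    using assms(6) by (auto simp: approx_K_atomic_decomposition_with_bounds_def)
  have "bounded_linear K"
    using assms(7) by (simp add: bounded_operator_def)
  then have lowK: "lower_bound m N K h (A / onorm K)"
    using lower_bound_comp_bounded_linear[OF low] assms(8) by blast
  have "(\<lambda>n. \<Sum>i=1..m n. smul (h n i y) (K (x i))) \<longlonglongrightarrow> K y" for y
    using decomp bounded_operator_tendsto_sum[OF assms(7), of "\<lambda>n i. h n i y" x]
    by (simp add: approx_K_atomic_decomposition_def)
  then have "approx_K_atomic_decomposition smul m S N K (\<lambda>n. K (x n)) h"
    using decomp assms(7) ordered_bounds_exist[OF lowK up]
    by (simp add: approx_K_atomic_decomposition_def)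
  with lowK up show ?thesis
    by (simp add: approx_K_atomic_decomposition_with_bounds_def)
qed

end
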